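(* Let $R\in\mathbb{C}^{n,n}$ be Hermitian positive semi-definite, let $J\in\mathbb{C}^{n,n}$ be skew-Hermitian, and let $Q,A_0,A_2\in\mathbb{C}^{n,n}$ be such that $Q^*A_2$ and $Q^*A_0$ are Hermitian positive semi-definite. Assume also that $\ker(Q^*A_0)\cap\ker(Q^*RQ)\cap\ker(Q^*JQ)\cap\ker(Q^*A_2)=\{0\}$. Then the matrix polynomial $P(\lambda)=\lambda^2A_2+\lambda(J+R)Q+A_0$ is regular and hyperstable with respect to the open right half-plane $\{z\in\mathbb{C}:\operatorname{Re}z>0\}$.
   Context: For a nonempty open or closed $D\subseteq\mathbb{C}$, a matrix polynomial $P(\lambda)$ with coefficients in $\mathbb{C}^{n,n}$ is hyperstable with respect to $D$ if for every $x\in\mathbb{C}^n\setminus\{0\}$ there exists $y\in\mathbb{C}^n\setminus\{0\}$ such that $y^*P(\mu)x\neq0$ for all $\mu\in D$. $P(\lambda)$ is regular if $\lambda\mapsto\det P(\lambda)$ is a nonzero polynomial. *)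

theory Defs
  imports "HOL-Analysis.Analysis" "HOL-Computational_Algebra.Polynomial"
begin

definition cmat_adjoint :: "complex^'n^'m \<Rightarrow> complex^'m^'n" where
  "cmat_adjoint A = transpose (map_matrix cnj A)"

(* y^* x, antilinear in the first argument *)
definition cinner_vec :: "complex^'n \<Rightarrow> complex^'n \<Rightarrow> complex" where
  "cinner_vec y x = (\<Sum>i\<in>UNIV. cnj (y $ i) * x $ i)"

definition hermitian_mat :: "complex^'n^'n \<Rightarrow> bool" where
  "hermitian_mat A \<longleftrightarrow> cmat_adjoint A = A"

definition skew_hermitian_mat :: "complex^'n^'n \<Rightarrow> bool" where
  "skew_hermitian_mat A \<longleftrightarrow> cmat_adjoint A = - A"

(* x^* A x is real for Hermitian A, so taking the real part loses nothing. *)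
definition hermitian_psd :: "complex^'n^'n \<Rightarrow> bool" where
  "hermitian_psd A \<longleftrightarrow> hermitian_mat A \<and> (\<forall>x. 0 \<le> Re (cinner_vec x (A *v x)))"

definition mat_ker :: "complex^'n^'m \<Rightarrow> (complex^'n) set" where
  "mat_ker A = {x. A *v x = 0}"

(* A matrix polynomial is a polynomial with matrix coefficients. The library's poly cannot be used
   for evaluation: it would multiply matrices entrywise, and its argument would be a matrix. *)
definition mpoly_eval :: "(complex^'n^'n) poly \<Rightarrow> complex \<Rightarrow> complex^'n^'n" where
  "mpoly_eval P z = (\<Sum>i\<le>degree P. map_matrix ((*) (z ^ i)) (coeff P i))"

definition regular_mpoly :: "(complex^'n^'n) poly \<Rightarrow> bool" where
  "regular_mpoly P \<longleftrightarrow> (\<exists>p :: complex poly. p \<noteq> 0 \<and> (\<forall>z. det (mpoly_eval P z) = poly p z))"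

(* The notion is only meant for nonempty sets that are open or closed; this is made part of
   the predicate. *)
definition hyperstable :: "complex set \<Rightarrow> (complex^'n^'n) poly \<Rightarrow> bool" where
  "hyperstable D P \<longleftrightarrow>
     D \<noteq> {} \<and> (open D \<or> closed D) \<and>
     (\<forall>x. x \<noteq> 0 \<longrightarrow>
       (\<exists>y. y \<noteq> 0 \<and> (\<forall>\<mu>\<in>D. cinner_vec y (mpoly_eval P \<mu> *v x) \<noteq> 0)))"

lemma mpoly_eval_quadratic:
  "mpoly_eval [:C, B, A:] z = map_matrix ((*) (z\<^sup>2)) A + map_matrix ((*) z) B + C"
proof -
  have "mpoly_eval [:C, B, A:] z
      = (\<Sum>i\<le>2. map_matrix ((*) (z ^ i)) (coeff [:C, B, A:] i))"
    unfolding mpoly_eval_def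
    by (rule sum.mono_neutral_left)
       (auto simp: coeff_eq_0 vec_eq_iff intro: order_trans[OF degree_pCons_le])
  also have "\<dots> = map_matrix ((*) (z\<^sup>2)) A + map_matrix ((*) z) B + C"
    by (simp add: numeral_2_eq_2 vec_eq_iff)
  finally show ?thesis .
qed

end

theory Submission
  imports Defs
begin

text \<open>
  For \<open>x \<noteq> 0\<close> the test vector \<open>y = Q x\<close> gives
  \<open>y\<^sup>* P(\<mu>) x / \<mu> = \<mu> a + c / \<mu> + r + i s\<close> with \<open>a, c, r \<ge> 0\<close> and \<open>s\<close> real, whose real part is
  positive on the right half-plane unless \<open>a = c = r = 0\<close>.  In the exceptional case semi-definiteness
  puts \<open>x\<close> into the kernels of \<open>Q\<^sup>* A\<^sub>2\<close>, \<open>Q\<^sup>* A\<^sub>0\<close> and \<open>Q\<^sup>* R Q\<close>, so that \<open>w = Q\<^sup>* J Q x \<noteq> 0\<close>, and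
  \<open>y = Q w\<close> gives \<open>y\<^sup>* P(\<mu>) x = \<mu> \<parallel>w\<parallel>\<^sup>2\<close>.  Hyperstability makes \<open>P(\<mu>)\<close> injective for every \<open>\<mu>\<close> in
  the region, which implies regularity.
\<close>

lemma cinner_vec_add_right: "cinner_vec y (x + z) = cinner_vec y x + cinner_vec y z"
  by (simp add: cinner_vec_def algebra_simps sum.distrib)

lemma cinner_vec_add_left: "cinner_vec (x + z) y = cinner_vec x y + cinner_vec z y"
  by (simp add: cinner_vec_def algebra_simps sum.distrib)

lemma cinner_vec_scale_right: "cinner_vec y (c *s x) = c * cinner_vec y x"
  by (simp add: cinner_vec_def sum_distrib_left mult_ac)

lemma cinner_vec_scale_left: "cinner_vec (c *s y) x = cnj c * cinner_vec y x"
  by (simp add: cinner_vec_def sum_distrib_left mult_ac)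

lemma cinner_vec_zero [simp]: "cinner_vec 0 x = 0" "cinner_vec y 0 = 0"
  by (simp_all add: cinner_vec_def)

lemma cnj_cinner_vec: "cnj (cinner_vec x y) = cinner_vec y x"
  by (simp add: cinner_vec_def mult_ac)

text \<open>Having the value as \<open>of_real\<close> of a sum of squares yields both definiteness
  and the real number \<open>N\<close> used in \<open>hermitian_psd_kernel\<close>.\<close>

lemma cinner_vec_self: "cinner_vec x x = of_real (\<Sum>i\<in>UNIV. (cmod (x $ i))\<^sup>2)"
  by (simp only: cinner_vec_def of_real_sum complex_norm_square mult.commute)

lemma cinner_vec_self_eq_0_iff: "cinner_vec x x = 0 \<longleftrightarrow> x = 0"
  by (simp add: cinner_vec_self sum_nonneg_eq_0_iff vec_eq_iff del: of_real_sum)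

lemma cinner_vec_adjoint_left:
  "cinner_vec (cmat_adjoint A *v y) x = cinner_vec y (A *v x)"
proof -
  have "cinner_vec (cmat_adjoint A *v y) x
      = (\<Sum>i\<in>UNIV. \<Sum>j\<in>UNIV. cnj (y $ j) * (A $ j $ i * x $ i))"
    by (simp add: cinner_vec_def cmat_adjoint_def matrix_vector_mult_def transpose_def
        sum_distrib_left sum_distrib_right mult_ac)
  also have "\<dots> = (\<Sum>j\<in>UNIV. \<Sum>i\<in>UNIV. cnj (y $ j) * (A $ j $ i * x $ i))"
    by (rule sum.swap)
  also have "\<dots> = cinner_vec y (A *v x)"
    by (simp add: cinner_vec_def matrix_vector_mult_def sum_distrib_left)
  finally show ?thesis .
qed

lemma cmat_adjoint_cmat_adjoint [simp]: "cmat_adjoint (cmat_adjoint A) = A"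
  by (simp add: cmat_adjoint_def transpose_def vec_eq_iff)

lemma cinner_vec_adjoint_right:
  "cinner_vec y (cmat_adjoint A *v x) = cinner_vec (A *v y) x"
  using cinner_vec_adjoint_left[of "cmat_adjoint A" y x] by simp

lemma hermitian_mat_cinner_vec_real:
  assumes "hermitian_mat A"
  shows "Im (cinner_vec x (A *v x)) = 0"
proof -
  have "cnj (cinner_vec x (A *v x)) = cinner_vec x (A *v x)"
    using assms cinner_vec_adjoint_left[of A x x] by (simp add: cnj_cinner_vec hermitian_mat_def)
  then show ?thesis
    by (simp add: complex_eq_iff)
qed

lemma skew_hermitian_mat_cinner_vec_imaginary:
  assumes "skew_hermitian_mat A"
  shows "Re (cinner_vec x (A *v x)) = 0"
proof -
  have "cnj (cinner_vec x (A *v x)) = cinner_vec (A *v x) x"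
    by (rule cnj_cinner_vec)
  \<comment> \<open>The sign moves onto the matrix because \<open>- A\<close> is the adjoint of
    \<open>A\<close>; the form thus equals minus its own conjugate.\<close>
  also have "\<dots> = - cinner_vec ((- A) *v x) x"
    by (simp add: cinner_vec_def matrix_vector_mult_def sum_negf)
  also have "\<dots> = - cinner_vec x (A *v x)"
    using assms cinner_vec_adjoint_left[of A x x] by (simp add: skew_hermitian_mat_def)
  finally show ?thesis
    by (simp add: complex_eq_iff)
qed

text \<open>Perturb \<open>x\<close> in the direction \<open>y = A *v x\<close>. As the form
  vanishes at \<open>x\<close>, its value at \<open>x + t y\<close> is
  \<open>t\<^sup>2 * K + 2 * t * N\<close> with \<open>N\<close> the squared norm of
  \<open>y\<close>; if \<open>N > 0\<close>, the linear term makes this negative for small negative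
  \<open>t\<close>.\<close>

lemma hermitian_psd_kernel:
  assumes "hermitian_psd A" and "Re (cinner_vec x (A *v x)) = 0"
  shows "A *v x = 0"
proof (rule ccontr)
  assume nz: "A *v x \<noteq> 0"
  define y where "y = A *v x"
  define N where "N = (\<Sum>i\<in>UNIV. (cmod (y $ i))\<^sup>2)"
  define K where "K = Re (cinner_vec y (A *v y))"
  have N: "cinner_vec y y = of_real N"
    by (simp add: N_def cinner_vec_self)
  have "N \<noteq> 0"
    using nz cinner_vec_self_eq_0_iff[of y] N by (auto simp: y_def)
  moreover have "N \<ge> 0"
    by (simp add: N_def sum_nonneg)
  ultimately have "N > 0" by simp
  have "K \<ge> 0"
    using assms by (simp add: K_def hermitian_psd_def)
  have xAy: "cinner_vec x (A *v y) = of_real N"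
    using assms cinner_vec_adjoint_left[of A x y]
    by (simp add: hermitian_psd_def hermitian_mat_def N y_def[symmetric])
  have ineq: "0 \<le> t\<^sup>2 * K + 2 * t * N" for t :: real
  proof -
    have eq: "A *v (x + complex_of_real t *s y) = y + complex_of_real t *s (A *v y)"
      by (simp only: matrix_vector_right_distrib vector_scalar_commute y_def)
    have "0 \<le> Re (cinner_vec (x + complex_of_real t *s y) (A *v (x + complex_of_real t *s y)))"
      using assms by (simp add: hermitian_psd_def)
    also have "\<dots> = t\<^sup>2 * K + 2 * t * N"
      unfolding eq using assms(2)
      by (simp add: cinner_vec_add_left cinner_vec_add_right cinner_vec_scale_left
          cinner_vec_scale_right N xAy K_def[symmetric] y_def[symmetric] power2_eq_square
          algebra_simps)
    finally show ?thesis .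
  qed
  \<comment> \<open>Any positive \<open>t\<close> with \<open>t * K < 2 * N\<close> would do, since
    \<open>ineq\<close> is applied to \<open>- t\<close>; the denominator \<open>K + 1\<close> also
    covers \<open>K = 0\<close>.\<close>
  define t where "t = N / (K + 1)"
  have "t > 0"
    using \<open>N > 0\<close> \<open>K \<ge> 0\<close> by (simp add: t_def)
  have "t * K < 2 * N"
    using \<open>N > 0\<close> \<open>K \<ge> 0\<close> mult_nonneg_nonneg[of N K]
    by (simp add: t_def field_simps add_nonneg_pos)
  then have "t * (t * K) < t * (2 * N)"
    using \<open>t > 0\<close> by simp
  then show False
    using ineq[of "- t"] by (simp add: power2_eq_square algebra_simps)
qed

lemma map_matrix_mult_vector: "map_matrix ((*) c) A *v x = c *s (A *v x)"
  by (simp add: vec_eq_iff matrix_vector_mult_def sum_distrib_left mult.assoc)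

text \<open>The Leibniz formula uses only ring operations, and evaluation at \<open>z\<close> is a
  ring homomorphism.\<close>

lemma det_poly_entries:
  fixes p :: "'n::finite \<Rightarrow> 'n \<Rightarrow> 'a::comm_ring_1 poly"
  shows "det (\<chi> i j. poly (p i j) z) = poly (det (\<chi> i j. p i j)) z"
  by (simp add: det_def poly_sum poly_prod)

lemma mpoly_eval_poly_entries:
  "mpoly_eval P z = (\<chi> i j. poly (\<Sum>k\<le>degree P. monom (coeff P k $ i $ j) k) z)"
  by (simp add: mpoly_eval_def vec_eq_iff poly_sum poly_monom mult.commute)

lemma regular_mpolyI:
  assumes "det (mpoly_eval P z) \<noteq> 0"
  shows "regular_mpoly P"
proof -
  \<comment> \<open>The determinant is taken over the ring of polynomials, after collecting the
    coefficients of \<open>P\<close> entry by entry. A single nonzero value then shows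
    \<open>p \<noteq> 0\<close>.\<close>
  define p where "p = det (\<chi> i j. \<Sum>k\<le>degree P. monom (coeff P k $ i $ j) k)"
  have eval: "det (mpoly_eval P z) = poly p z" for z
    unfolding p_def mpoly_eval_poly_entries by (rule det_poly_entries)
  then have "p \<noteq> 0"
    using assms by auto
  with eval show ?thesis
    by (auto simp: regular_mpoly_def)
qed

lemma hyperstable_imp_regular_mpoly:
  assumes "hyperstable D P"
  shows "regular_mpoly P"
proof -
  obtain z where z: "z \<in> D"
    using assms by (auto simp: hyperstable_def)
  have "mpoly_eval P z *v x \<noteq> 0" if "x \<noteq> 0" for x
    using assms z that unfolding hyperstable_def by fastforce
  then have "det (mpoly_eval P z) \<noteq> 0"
    by (metis invertible_det_nz invertible_left_inverse matrix_left_invertible_ker)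
  then show ?thesis
    by (rule regular_mpolyI)
qed

text \<open>Division by \<mu> works because inversion preserves the right half-plane. Only
  \<open>b\<close> is complex: it will absorb the imaginary contribution of
  \<open>J\<close>.\<close>

lemma quadratic_nonzero_right_half_plane:
  fixes \<mu> b :: complex and a c :: real
  assumes "Re \<mu> > 0" "a \<ge> 0" "c \<ge> 0" "Re b \<ge> 0" "a > 0 \<or> c > 0 \<or> Re b > 0"
  shows "\<mu>\<^sup>2 * of_real a + \<mu> * b + of_real c \<noteq> 0"
proof
  assume eq: "\<mu>\<^sup>2 * of_real a + \<mu> * b + of_real c = 0"
  have "\<mu> \<noteq> 0"
    using assms(1) by auto
  then have "\<mu> * of_real a + b + of_real c * inverse \<mu>
      = (\<mu>\<^sup>2 * of_real a + \<mu> * b + of_real c) * inverse \<mu>"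
    by (simp add: field_simps power2_eq_square)
  then have "Re (\<mu> * of_real a + b + of_real c * inverse \<mu>) = 0"
    by (simp add: eq)
  then have "Re \<mu> * a + Re b + c * Re (inverse \<mu>) = 0"
    by simp
  moreover have "Re (inverse \<mu>) > 0"
    using assms(1) by (simp add: add_pos_nonneg)
  ultimately show False
    using assms
    by (smt (verit) mult_nonneg_nonneg mult_pos_pos)
qed

theorem corollary7p5:
  fixes R J Q A0 A2 :: "complex^'n^'n"
  assumes "hermitian_psd R"
    and "skew_hermitian_mat J"
    and "hermitian_psd (cmat_adjoint Q ** A2)"
    and "hermitian_psd (cmat_adjoint Q ** A0)"
    and "mat_ker (cmat_adjoint Q ** A0) \<inter> mat_ker (cmat_adjoint Q ** R ** Q)
         \<inter> mat_ker (cmat_adjoint Q ** J ** Q) \<inter> mat_ker (cmat_adjoint Q ** A2) = {0}"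
  shows "regular_mpoly [:A0, (J + R) ** Q, A2:] \<and>
         hyperstable {z. Re z > 0} [:A0, (J + R) ** Q, A2:]"
proof -
  let ?P = "[:A0, (J + R) ** Q, A2:]" and ?D = "{z::complex. Re z > 0}"
  \<comment> \<open>Test vectors \<open>Q *v w\<close> bring in the products of \<open>A2\<close>
    and \<open>A0\<close> with the adjoint of \<open>Q\<close>. The vector \<open>w\<close> stays
    free, as the two cases below choose it differently.\<close>
  have eval: "cinner_vec (Q *v w) (mpoly_eval ?P \<mu> *v x)
      = \<mu>\<^sup>2 * cinner_vec w (cmat_adjoint Q ** A2 *v x)
        + \<mu> * (cinner_vec (Q *v w) (J *v (Q *v x)) + cinner_vec (Q *v w) (R *v (Q *v x)))
        + cinner_vec w (cmat_adjoint Q ** A0 *v x)" for w x \<mu>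
    by (simp add: mpoly_eval_quadratic matrix_vector_mult_add_rdistrib map_matrix_mult_vector
        cinner_vec_add_right cinner_vec_scale_right cinner_vec_adjoint_right
        matrix_vector_mul_assoc[symmetric] distrib_left)
  have "\<exists>y. y \<noteq> 0 \<and> (\<forall>\<mu>\<in>?D. cinner_vec y (mpoly_eval ?P \<mu> *v x) \<noteq> 0)" if "x \<noteq> 0" for x
  proof -
    define a where "a = Re (cinner_vec x (cmat_adjoint Q ** A2 *v x))"
    define c where "c = Re (cinner_vec x (cmat_adjoint Q ** A0 *v x))"
    define r where "r = Re (cinner_vec (Q *v x) (R *v (Q *v x)))"
    have nonneg: "a \<ge> 0" "c \<ge> 0" "r \<ge> 0"
      using assms by (auto simp: a_def c_def r_def hermitian_psd_def)
    \<comment> \<open>That \<open>Q *v w\<close> is nonzero is left for later: it follows from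
      nonvanishing at the single point 1.\<close>
    have "\<exists>w. \<forall>\<mu>\<in>?D. cinner_vec (Q *v w) (mpoly_eval ?P \<mu> *v x) \<noteq> 0"
    proof (cases "a = 0 \<and> c = 0 \<and> r = 0")
      case True
      \<comment> \<open>For \<open>R\<close> the kernel lemma is applied at \<open>Q *v x\<close>,
        so the \<open>R\<close> term of \<open>eval\<close> vanishes for every
        \<open>w\<close>.\<close>
      then have ker: "cmat_adjoint Q ** A2 *v x = 0" "cmat_adjoint Q ** A0 *v x = 0"
          "R *v (Q *v x) = 0"
        using assms hermitian_psd_kernel by (auto simp: a_def c_def r_def)
      define w where "w = cmat_adjoint Q ** J ** Q *v x"
      have "w \<noteq> 0"
      proof
        assume "w = 0"
        with ker have "x \<in> mat_ker (cmat_adjoint Q ** A0) \<inter> mat_ker (cmat_adjoint Q ** R ** Q)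
         \<inter> mat_ker (cmat_adjoint Q ** J ** Q) \<inter> mat_ker (cmat_adjoint Q ** A2)"
          by (simp add: mat_ker_def w_def matrix_vector_mul_assoc[symmetric])
        with assms(5) \<open>x \<noteq> 0\<close> show False by simp
      qed
      have "w = cmat_adjoint Q *v (J *v (Q *v x))"
        by (simp add: w_def matrix_vector_mul_assoc matrix_mul_assoc)
      then have "cinner_vec (Q *v w) (J *v (Q *v x)) = cinner_vec w w"
        by (metis cinner_vec_adjoint_right)
      then have "cinner_vec (Q *v w) (mpoly_eval ?P \<mu> *v x) \<noteq> 0" if "\<mu> \<in> ?D" for \<mu>
        using \<open>w \<noteq> 0\<close> that unfolding eval ker by (auto simp: cinner_vec_self_eq_0_iff)
      then show ?thesis by blast
    next
      case False
      have real: "cinner_vec x (cmat_adjoint Q ** A2 *v x) = of_real a"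
          "cinner_vec x (cmat_adjoint Q ** A0 *v x) = of_real c"
        using assms(3,4) hermitian_mat_cinner_vec_real[of "cmat_adjoint Q ** A2" x]
          hermitian_mat_cinner_vec_real[of "cmat_adjoint Q ** A0" x]
        by (auto simp: a_def c_def complex_eq_iff hermitian_psd_def)
      \<comment> \<open>Here \<open>w = x\<close>, and the middle coefficient has real part
        \<open>r\<close> because the \<open>J\<close> term is purely imaginary.\<close>
      have "cinner_vec (Q *v x) (mpoly_eval ?P \<mu> *v x) \<noteq> 0" if "\<mu> \<in> ?D" for \<mu>
        unfolding eval real
        using that False nonneg skew_hermitian_mat_cinner_vec_imaginary[OF assms(2)]
        by (intro quadratic_nonzero_right_half_plane) (auto simp: r_def)
      then show ?thesis by blast
    qed
    then obtain w where w: "\<forall>\<mu>\<in>?D. cinner_vec (Q *v w) (mpoly_eval ?P \<mu> *v x) \<noteq> 0" ..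
    have "1 \<in> ?D" by simp
    with w have "Q *v w \<noteq> 0" by fastforce
    with w show ?thesis by blast
  qed
  moreover have "open ?D" "?D \<noteq> {}"
    using open_halfspace_Re_gt[of 0] by (auto intro: exI[of _ 1])
  ultimately have "hyperstable ?D ?P"
    by (simp add: hyperstable_def)
  then show ?thesis
    using hyperstable_imp_regular_mpoly by blast
qed

end
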